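(* Let $k\in\mathbb{N}$ and $c_1,\dots,c_k\in\mathbb{Z}\setminus\{0\}$ be such that $c_1+\cdots+c_k=0$. Then for any finite coloring of $\mathbb{N}$ there exist pairwise distinct $a_0,\dots,a_k\in\mathbb{N}$, all of the same color, such that $$c_1a_1^2+\cdots+c_ka_k^2=a_0.$$
   Context: $\mathbb{N}=\{1,2,\dots\}$. A finite coloring of $\mathbb{N}$ is a finite partition $\mathbb{N}=C_1\cup\cdots\cup C_r$; numbers have the same color if they lie in the same cell. *)

theory Defs
  imports Complex_Main "HOL-Library.Disjoint_Sets"
begin

end

theory Submission
  imports Defs
begin

text \<open>
  The equation is solved by a linear substitution.  Put \<open>a i = z + d i * h\<close> for \<open>i \<ge> 1\<close>, where the
  integers \<open>d i\<close> satisfy \<open>\<Sum> c i * (d i)\<^sup>2 = 0\<close>.  As \<open>\<Sum> c i = 0\<close>, the terms in \<open>z\<^sup>2\<close> and in \<open>h\<^sup>2\<close>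
  both vanish and the left-hand side becomes \<open>D * h * z\<close> with \<open>D = 2 * (\<Sum> c i * d i)\<close>.  Such \<open>d\<close>,
  pairwise distinct and with \<open>D > 0\<close>, exist because the quadratic form has the isotropic vector
  \<open>(1, \<dots>, 1)\<close>: the line through a generic vector in the direction \<open>(1, \<dots>, 1)\<close> meets the cone in a
  further point (\<open>isotropic_vector_exists\<close>).  What is left is a Ramsey statement: for all \<open>D\<close> and \<open>M\<close>
  one colour contains \<open>D * h * z\<close> together with all \<open>z + d * h\<close>, \<open>\<bar>d\<bar> \<le> M\<close>
  (\<open>monochromatic_multiple_and_translates\<close>).

  That statement follows from a chain of piecewise syndetic sets \<open>B 0, B 1, \<dots>\<close>, each
  contained in one colour class.  Given \<open>B j\<close>, van der Waerden's theorem in piecewise syndetic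
  sets supplies \<open>n \<ge> 1\<close> such that the \<open>u\<close> with \<open>u + e * n \<in> B j\<close> for all small \<open>e\<close> form a piecewise
  syndetic set.  Multiplying this set by \<open>D * n\<close> and restricting it to a suitable colour yields
  \<open>B (j + 1)\<close>.  Two of the sets in the chain, \<open>B i\<close> and \<open>B j\<close> with \<open>i < j\<close>, have the same colour.
  An element of \<open>B j\<close> is \<open>D * n * u\<close>, and dividing \<open>u + e * n\<close> by the earlier factors leads into
  \<open>B i\<close>; for the multiples \<open>e\<close> of the square of these factors this gives exactly the pattern.

  Van der Waerden's theorem is proved by the same kind of chain, with translations in
  place of dilations (\<open>longer_progression\<close>).  It alternates with the statement that one common
  difference works for a piecewise syndetic set of starting points
  (\<open>common_difference_piecewise_syndetic\<close>).  That step is a compactness argument, and to make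
  it available all sets live in countably many disjoint copies of the integers: a sequence of
  finite counterexamples can be stored in the copies, one in each, and is then a single set
  of the same type.
\<close>

section \<open>Piecewise syndetic sets in countably many copies of the integers\<close>

text \<open>
  A set is piecewise syndetic if, for some bound \<open>m\<close> on the gaps, there are arbitrarily long
  intervals in which it has no larger gap.  The first component selects a copy of the
  integers; the long intervals may lie in different copies.
\<close>

definition piecewise_syndetic :: "(nat \<times> int) set \<Rightarrow> bool" where
  "piecewise_syndetic A \<longleftrightarrow>
     (\<exists>m. \<forall>N. \<exists>p a. \<forall>b. a \<le> b \<and> b \<le> a + N \<longrightarrow> (\<exists>x. b \<le> x \<and> x \<le> b + m \<and> (p, x) \<in> A))"

lemma piecewise_syndeticE:
  assumes "piecewise_syndetic A"
  obtains m p a where "m \<ge> 0"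
    "\<And>N b. a N \<le> b \<Longrightarrow> b \<le> a N + N \<Longrightarrow> \<exists>x. b \<le> x \<and> x \<le> b + m \<and> (p N, x) \<in> A"
proof -
  obtain m where m: "\<And>N. \<exists>p a. \<forall>b. a \<le> b \<and> b \<le> a + N \<longrightarrow> (\<exists>x. b \<le> x \<and> x \<le> b + m \<and> (p, x) \<in> A)"
    using assms unfolding piecewise_syndetic_def by blast
  obtain p a where "\<And>N b. a N \<le> b \<Longrightarrow> b \<le> a N + N \<Longrightarrow> \<exists>x. b \<le> x \<and> x \<le> b + m \<and> (p N, x) \<in> A"
    using m by metis
  moreover from this[of 0 "a 0"] have "m \<ge> 0" by auto
  ultimately show thesis using that by blast
qed

lemma piecewise_syndeticI:
  assumes "\<And>N b. a N \<le> b \<Longrightarrow> b \<le> a N + N \<Longrightarrow> \<exists>x. b \<le> x \<and> x \<le> b + m \<and> (p N, x) \<in> A"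
  shows "piecewise_syndetic A"
  unfolding piecewise_syndetic_def
proof (intro exI[of _ m] allI)
  fix N
  show "\<exists>p a. \<forall>b. a \<le> b \<and> b \<le> a + N \<longrightarrow> (\<exists>x. b \<le> x \<and> x \<le> b + m \<and> (p, x) \<in> A)"
    using assms by (intro exI[of _ "p N"] exI[of _ "a N"]) blast
qed

lemma piecewise_syndetic_nonempty:
  assumes "piecewise_syndetic A"
  shows "\<exists>p x. (p, x) \<in> A"
proof -
  obtain m p a where
    "\<And>N b. a N \<le> b \<Longrightarrow> b \<le> a N + N \<Longrightarrow> \<exists>x. b \<le> x \<and> x \<le> b + m \<and> (p N, x) \<in> A"
    using piecewise_syndeticE[OF assms] by metis
  from this[of 0 "a 0"] show ?thesis by auto
qed

lemma piecewise_syndetic_mono: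
  assumes "piecewise_syndetic A" "A \<subseteq> B"
  shows "piecewise_syndetic B"
  using assms unfolding piecewise_syndetic_def by (meson subsetD)

lemma piecewise_syndetic_translate:
  assumes "piecewise_syndetic A"
  shows "piecewise_syndetic {(p, x). (p, x + s) \<in> A}"
proof -
  obtain m p a where m: "m \<ge> 0"
    "\<And>N b. a N \<le> b \<Longrightarrow> b \<le> a N + N \<Longrightarrow> \<exists>x. b \<le> x \<and> x \<le> b + m \<and> (p N, x) \<in> A"
    using piecewise_syndeticE[OF assms] by metis
  have "\<exists>x. b \<le> x \<and> x \<le> b + m \<and> (p N, x + s) \<in> A"
    if b: "a N - s \<le> b" "b \<le> a N - s + N" for N b
  proof -
    obtain x where "b + s \<le> x" "x \<le> b + s + m" "(p N, x) \<in> A"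
      using m(2)[of N "b + s"] b by auto
    then show ?thesis by (intro exI[of _ "x - s"]) auto
  qed
  then show ?thesis
    by (intro piecewise_syndeticI[where a = "\<lambda>N. a N - s" and m = m and p = p]) simp
qed

lemma piecewise_syndetic_dilate:
  assumes "piecewise_syndetic A" "q \<ge> 1"
  shows "piecewise_syndetic {(p, y). \<exists>x. y = q * x \<and> (p, x) \<in> A}"
proof -
  obtain m p a where m: "m \<ge> 0"
    "\<And>N b. a N \<le> b \<Longrightarrow> b \<le> a N + N \<Longrightarrow> \<exists>x. b \<le> x \<and> x \<le> b + m \<and> (p N, x) \<in> A"
    using piecewise_syndeticE[OF assms(1)] by metis
  have "\<exists>y. b \<le> y \<and> y \<le> b + q * (m + 1) \<and> (\<exists>x. y = q * x \<and> (p N, x) \<in> A)"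
    if b: "q * a N \<le> b" "b \<le> q * a N + N" for N b
  proof -
    \<comment> \<open>\<open>q * r\<close> is the least multiple of \<open>q\<close> that is at least \<open>b\<close>.\<close>
    define r where "r = - ((- b) div q)"
    have r: "b \<le> q * r" "q * r < b + q"
    proof -
      have "- b = q * ((- b) div q) + (- b) mod q" by simp
      moreover have "0 \<le> (- b) mod q" "(- b) mod q < q" using assms(2) by auto
      moreover have "q * r = - (q * ((- b) div q))" by (simp add: r_def)
      ultimately show "b \<le> q * r" "q * r < b + q" by linarith+
    qed
    have "q * a N \<le> q * r" using b r by linarith
    then have r1: "a N \<le> r" using assms(2) by simp
    have "r \<le> a N + N"
    proof (rule ccontr)
      assume "\<not> r \<le> a N + N"
      then have "q * (a N + N + 1) \<le> q * r" using assms(2) by (intro mult_left_mono) auto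
      moreover have "N \<le> q * N"
        using mult_right_mono[of 1 q N] assms(2) b by auto
      ultimately show False using r b by (simp add: algebra_simps)
    qed
    then obtain x where x: "r \<le> x" "x \<le> r + m" "(p N, x) \<in> A" using m(2) r1 by blast
    have "q * r \<le> q * x" "q * x \<le> q * (r + m)"
      using x assms(2) by (intro mult_left_mono; simp)+
    moreover have "q * (r + m) = q * r + q * m" "q * (m + 1) = q * m + q"
      by (simp_all add: algebra_simps)
    ultimately have "b \<le> q * x" "q * x \<le> b + q * (m + 1)" using r by linarith+
    then show ?thesis using x by blast
  qed
  then show ?thesis
    by (intro piecewise_syndeticI[where a = "\<lambda>N. q * a N" and m = "q * (m + 1)" and p = p]) simp
qed

text \<open>
  Reading the definition negatively: in a long interval where \<open>A \<union> B\<close> has gaps at most \<open>m\<close>, a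
  set \<open>A\<close> that is not piecewise syndetic misses a block of length \<open>m\<close> in every stretch of some
  bounded length \<open>L\<close>, and \<open>B\<close> must meet that block.
\<close>

lemma piecewise_syndetic_Un:
  assumes "piecewise_syndetic (A \<union> B)"
  shows "piecewise_syndetic A \<or> piecewise_syndetic B"
proof (cases "piecewise_syndetic A")
  case nA: False
  obtain m p a where m: "m \<ge> 0"
    "\<And>N b. a N \<le> b \<Longrightarrow> b \<le> a N + N \<Longrightarrow> \<exists>x. b \<le> x \<and> x \<le> b + m \<and> (p N, x) \<in> A \<union> B"
    using piecewise_syndeticE[OF assms] by metis
  obtain L where L: "\<And>p a. \<exists>b. a \<le> b \<and> b \<le> a + L \<and> (\<forall>x. b \<le> x \<and> x \<le> b + m \<longrightarrow> (p, x) \<notin> A)"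
    using nA unfolding piecewise_syndetic_def by metis
  have "\<exists>x. b \<le> x \<and> x \<le> b + (L + m) \<and> (p (N + L), x) \<in> B"
    if b: "a (N + L) \<le> b" "b \<le> a (N + L) + N" for N b
  proof -
    obtain b' where b': "b \<le> b'" "b' \<le> b + L"
      "\<forall>x. b' \<le> x \<and> x \<le> b' + m \<longrightarrow> (p (N + L), x) \<notin> A"
      using L by blast
    obtain x where "b' \<le> x" "x \<le> b' + m" "(p (N + L), x) \<in> A \<union> B"
      using m(2)[of "N + L" b'] b b' by auto
    then show ?thesis using b' by (intro exI[of _ x]) auto
  qed
  then have "piecewise_syndetic B"
    by (intro piecewise_syndeticI[where a = "\<lambda>N. a (N + L)" and m = "L + m" and p = "\<lambda>N. p (N + L)"]) simp
  then show ?thesis by blast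
qed simp

lemma piecewise_syndetic_UN:
  assumes "finite I" "piecewise_syndetic (\<Union>i\<in>I. A i)"
  shows "\<exists>i\<in>I. piecewise_syndetic (A i)"
  using assms
proof (induction I rule: finite_induct)
  case empty
  then show ?case using piecewise_syndetic_nonempty by auto
next
  case (insert i I)
  then show ?case using piecewise_syndetic_Un[of "A i" "\<Union>i\<in>I. A i"] by auto
qed

corollary piecewise_syndetic_cover:
  assumes "piecewise_syndetic A" "finite I" "A \<subseteq> (\<Union>i\<in>I. C i)"
  shows "\<exists>i\<in>I. piecewise_syndetic (A \<inter> C i)"
proof -
  have "A \<subseteq> (\<Union>i\<in>I. A \<inter> C i)" using assms(3) by auto
  then show ?thesis
    using piecewise_syndetic_UN[OF assms(2)] piecewise_syndetic_mono[OF assms(1)] by blast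
qed

text \<open>
  Pieces of bounded length in the copies do not form a piecewise syndetic set, so a set that
  is contained in a translate of the triangle \<open>{(p, x). 0 \<le> x \<and> x \<le> int p}\<close> may be restricted
  to the triangle.
\<close>

lemma piecewise_syndetic_restrict_triangle:
  assumes "piecewise_syndetic A" "n \<ge> 0"
    and "\<And>p x. (p, x) \<in> A \<Longrightarrow> 0 \<le> x + n \<and> x + n \<le> int p"
  shows "piecewise_syndetic (A \<inter> {(p, x). 0 \<le> x \<and> x \<le> int p})"
proof -
  define band where "band = {(p::nat, x). - n \<le> x \<and> x < 0}"
  have "\<not> piecewise_syndetic band"
  proof
    assume band: "piecewise_syndetic band"
    obtain m p a where m: "m \<ge> 0"
      "\<And>N b. a N \<le> b \<Longrightarrow> b \<le> a N + N \<Longrightarrow> \<exists>x. b \<le> x \<and> x \<le> b + m \<and> (p N, x) \<in> band"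
      using piecewise_syndeticE[OF band] by metis
    \<comment> \<open>The first and the last block of an interval of length \<open>n + m\<close> cannot both meet the band.\<close>
    let ?N = "n + m"
    obtain y where "a ?N + ?N \<le> y" "(p ?N, y) \<in> band"
      using m(2)[of ?N "a ?N + ?N"] m(1) assms(2) by auto
    moreover obtain x where "x \<le> a ?N + m" "(p ?N, x) \<in> band"
      using m(2)[of ?N "a ?N"] m(1) assms(2) by auto
    ultimately show False unfolding band_def by auto
  qed
  moreover have "A \<subseteq> (A \<inter> {(p, x). 0 \<le> x \<and> x \<le> int p}) \<union> band"
  proof (rule subrelI)
    fix p x assume "(p, x) \<in> A"
    then show "(p, x) \<in> (A \<inter> {(p, x). 0 \<le> x \<and> x \<le> int p}) \<union> band"
      using assms(2) assms(3)[of p x] by (auto simp: band_def)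
  qed
  ultimately show ?thesis
    using piecewise_syndetic_Un piecewise_syndetic_mono[OF assms(1)] by blast
qed

section \<open>Van der Waerden's theorem in piecewise syndetic sets\<close>

text \<open>
  Compactness.  If no difference \<open>n\<close> works, then for every \<open>W\<close> the starting points with
  a difference \<open>n \<le> W\<close> do not form a piecewise syndetic set, so they avoid an interval of length
  \<open>W\<close> in which \<open>A\<close> has bounded gaps.  Storing the part of \<open>A\<close> in this interval in the copy with
  number about \<open>W\<close> yields a piecewise syndetic set without progressions.
\<close>

lemma common_difference_piecewise_syndetic:
  assumes progression: "\<And>A. piecewise_syndetic A \<Longrightarrow>
      \<exists>p x n. n \<ge> 1 \<and> (\<forall>i\<le>k. (p, x + int i * n) \<in> A)"
    and A: "piecewise_syndetic A"
  shows "\<exists>n\<ge>1. piecewise_syndetic {(p, x). \<forall>i\<le>k. (p, x + int i * n) \<in> A}"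
proof (cases "k = 0")
  case True
  then show ?thesis using A by (intro exI[of _ 1]) auto
next
  case False
  define start where "start n = {(p, x). \<forall>i\<le>k. (p, x + int i * n) \<in> A}" for n
  obtain m p a where m: "m \<ge> 0"
    "\<And>N b. a N \<le> b \<Longrightarrow> b \<le> a N + N \<Longrightarrow> \<exists>x. b \<le> x \<and> x \<le> b + m \<and> (p N, x) \<in> A"
    using piecewise_syndeticE[OF A] by metis
  show ?thesis
  proof (rule ccontr)
    assume contra: "\<not> ?thesis"
    have "\<exists>q b. (\<forall>b'. b \<le> b' \<and> b' \<le> b + W \<longrightarrow> (\<exists>x. b' \<le> x \<and> x \<le> b' + m \<and> (q, x) \<in> A)) \<and>
        (\<forall>x n. b \<le> x \<and> x \<le> b + (W + m) \<and> 1 \<le> n \<and> n \<le> W + m \<longrightarrow> (q, x) \<notin> start n)" for W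
    proof -
      have "\<not> piecewise_syndetic (\<Union>n\<in>{1..W + m}. start n)"
        using piecewise_syndetic_UN[of "{1..W + m}" start] contra start_def by auto
      then obtain L where L: "\<And>p a. \<exists>b. a \<le> b \<and> b \<le> a + L \<and>
          (\<forall>x. b \<le> x \<and> x \<le> b + (W + m) \<longrightarrow> (p, x) \<notin> (\<Union>n\<in>{1..W + m}. start n))"
        unfolding piecewise_syndetic_def by metis
      obtain b where b: "a (W + L) \<le> b" "b \<le> a (W + L) + L"
        "\<forall>x. b \<le> x \<and> x \<le> b + (W + m) \<longrightarrow> (p (W + L), x) \<notin> (\<Union>n\<in>{1..W + m}. start n)"
        using L by blast
      have "\<exists>x. b' \<le> x \<and> x \<le> b' + m \<and> (p (W + L), x) \<in> A" if "b \<le> b'" "b' \<le> b + W" for b'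
        using m(2)[of "W + L" b'] that b by auto
      then show ?thesis using b(3) by (intro exI[of _ "p (W + L)"] exI[of _ b]) auto
    qed
    then obtain q b where
      dense: "\<And>W b'. b W \<le> b' \<Longrightarrow> b' \<le> b W + W \<Longrightarrow>
          \<exists>x. b' \<le> x \<and> x \<le> b' + m \<and> (q W, x) \<in> A" and
      avoid: "\<And>W x n. b W \<le> x \<Longrightarrow> x \<le> b W + (W + m) \<Longrightarrow> 1 \<le> n \<Longrightarrow> n \<le> W + m \<Longrightarrow>
          (q W, x) \<notin> start n"
      by metis
    define A' where
      "A' = {(r, x). b (int r) \<le> x \<and> x \<le> b (int r) + (int r + m) \<and> (q (int r), x) \<in> A}"
    have "\<exists>x. b' \<le> x \<and> x \<le> b' + m \<and> (nat N, x) \<in> A'"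
      if b': "b (int (nat N)) \<le> b'" "b' \<le> b (int (nat N)) + N" for N b'
    proof -
      have "N \<ge> 0" using b' by linarith
      obtain x where "b' \<le> x" "x \<le> b' + m" "(q (int (nat N)), x) \<in> A"
        using dense[of "int (nat N)" b'] b' \<open>N \<ge> 0\<close> by auto
      then show ?thesis using b' \<open>N \<ge> 0\<close> unfolding A'_def by (intro exI[of _ x]) auto
    qed
    then have "piecewise_syndetic A'"
      by (rule piecewise_syndeticI[where a = "\<lambda>N. b (int (nat N))" and m = m and p = nat])
    then obtain r x n where n: "n \<ge> 1" and prog: "\<And>i. i \<le> k \<Longrightarrow> (r, x + int i * n) \<in> A'"
      using progression by blast
    have "(q (int r), x) \<in> start n" using prog unfolding start_def A'_def by auto
    \<comment> \<open>The first two terms lie in an interval of length \<open>r + m\<close>, which bounds the difference.\<close>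
    moreover have "b (int r) \<le> x" "x \<le> b (int r) + (int r + m)" "n \<le> int r + m"
      using prog[of 0] prog[of 1] False unfolding A'_def by auto
    ultimately show False using avoid n by blast
  qed
qed

text \<open>
  Colour focusing.  After its long intervals have been moved to the origin of the
  copies, finitely many translates of \<open>A\<close> cover the triangle.  The sets \<open>B j\<close> lie in the triangle,
  each in one of these translates, and adding \<open>i * n j\<close> with \<open>1 \<le> i \<le> k + 1\<close> leads from
  \<open>B (j + 1)\<close> to \<open>B j\<close>.  If \<open>B i\<close> and \<open>B j\<close> lie in the same translate, then a point of \<open>B j\<close>
  begins a progression with \<open>k + 2\<close> terms whose difference is the sum of the \<open>n l\<close>, \<open>i \<le> l < j\<close>.
\<close>

lemma longer_progression:
  assumes common_difference: "\<And>A. piecewise_syndetic A \<Longrightarrow>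
      \<exists>n\<ge>1. piecewise_syndetic {(p, x). \<forall>i\<le>k. (p, x + int i * n) \<in> A}"
    and A: "piecewise_syndetic A"
  shows "\<exists>p x n. n \<ge> 1 \<and> (\<forall>i\<le>Suc k. (p, x + int i * n) \<in> A)"
proof -
  obtain m q a where m: "m \<ge> 0"
    "\<And>N b. a N \<le> b \<Longrightarrow> b \<le> a N + N \<Longrightarrow> \<exists>x. b \<le> x \<and> x \<le> b + m \<and> (q N, x) \<in> A"
    using piecewise_syndeticE[OF A] by metis
  define X where "X = {(p, x). 0 \<le> x \<and> x \<le> int p}"
  define T where "T f = {(p, x). (q (int p), a (int p) + x + f) \<in> A}" for f
  have cover: "X \<subseteq> (\<Union>f\<in>{0..m}. T f)"
  proof
    fix z assume "z \<in> X"
    then obtain p x where z: "z = (p, x)" "0 \<le> x" "x \<le> int p" unfolding X_def by auto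
    then obtain y where "a (int p) + x \<le> y" "y \<le> a (int p) + x + m" "(q (int p), y) \<in> A"
      using m(2)[of "int p" "a (int p) + x"] by auto
    then show "z \<in> (\<Union>f\<in>{0..m}. T f)"
      unfolding T_def z by (auto intro!: bexI[of _ "y - (a (int p) + x)"])
  qed
  have "\<exists>x. b \<le> x \<and> x \<le> b + 0 \<and> (nat N, x) \<in> X" if "0 \<le> b" "b \<le> 0 + N" for N b
    using that unfolding X_def by auto
  then have X: "piecewise_syndetic X"
    by (rule piecewise_syndeticI[where a = "\<lambda>_. 0" and m = 0 and p = nat])
  define good where
    "good s \<longleftrightarrow> (case s of (B, f) \<Rightarrow> piecewise_syndetic B \<and> B \<subseteq> X \<inter> T f \<and> f \<in> {0..m})" for s
  define step where
    "step s s' \<longleftrightarrow> (\<exists>n\<ge>1. \<forall>p x. (p, x) \<in> fst s' \<longrightarrow>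
       (\<forall>i\<in>{1..Suc k}. (p, x + int i * n) \<in> fst s))"
    for s s' :: "(nat \<times> int) set \<times> int"
  have "\<exists>s. \<forall>j. good (s j) \<and> step (s j) (s (Suc j))"
  proof (rule dependent_nat_choice)
    obtain f where "f \<in> {0..m}" "piecewise_syndetic (X \<inter> T f)"
      using piecewise_syndetic_cover[OF X _ cover] by auto
    then show "\<exists>s. good s" by (intro exI[of _ "(X \<inter> T f, f)"]) (simp add: good_def)
  next
    fix s assume "good s"
    then obtain B f where s: "s = (B, f)" "piecewise_syndetic B" "B \<subseteq> X" by (auto simp: good_def)
    obtain n where n: "n \<ge> 1" "piecewise_syndetic {(p, x). \<forall>i\<le>k. (p, x + int i * n) \<in> B}"
      using common_difference[OF s(2)] by blast
    define E where "E = {(p, x). \<forall>i\<in>{1..Suc k}. (p, x + int i * n) \<in> B}"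
    \<comment> \<open>Moving the starting points back by \<open>n\<close> shifts the indices from \<open>0..k\<close> to \<open>1..k + 1\<close>.\<close>
    have "{(p, x). (p, x + n) \<in> {(p, x). \<forall>i\<le>k. (p, x + int i * n) \<in> B}} \<subseteq> E"
    proof (rule subrelI)
      fix p x assume "(p, x) \<in> {(p, x). (p, x + n) \<in> {(p, x). \<forall>i\<le>k. (p, x + int i * n) \<in> B}}"
      then have h: "(p, x + n + int i * n) \<in> B" if "i \<le> k" for i using that by auto
      have "(p, x + int i * n) \<in> B" if "i \<in> {1..Suc k}" for i
        using h[of "i - 1"] that by (auto simp: algebra_simps of_nat_diff)
      then show "(p, x) \<in> E" by (simp add: E_def)
    qed
    then have E: "piecewise_syndetic E"
      using piecewise_syndetic_mono[OF piecewise_syndetic_translate[OF n(2)]] by blast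
    have EB: "(p, x + int i * n) \<in> B" if "(p, x) \<in> E" "i \<in> {1..Suc k}" for p x i
      using that unfolding E_def by auto
    have "0 \<le> x + n \<and> x + n \<le> int p" if "(p, x) \<in> E" for p x
      using EB[OF that, of 1] s(3) unfolding X_def by auto
    then have EX: "piecewise_syndetic (E \<inter> X)"
      using piecewise_syndetic_restrict_triangle[OF E, of n] n(1) unfolding X_def by auto
    then obtain f' where "f' \<in> {0..m}" "piecewise_syndetic (E \<inter> X \<inter> T f')"
      using piecewise_syndetic_cover[OF EX, of "{0..m}" T] cover
      by (metis finite_atLeastAtMost_int inf.coboundedI2)
    moreover have "step s (E \<inter> X \<inter> T f', f')"
      unfolding step_def s(1) using EB n(1) by (intro exI[of _ n]) auto
    ultimately show "\<exists>s'. good s' \<and> step s s'"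
      by (intro exI[of _ "(E \<inter> X \<inter> T f', f')"]) (auto simp: good_def)
  qed
  then obtain s where s: "\<And>j. good (s j)" "\<And>j. step (s j) (s (Suc j))" by blast
  define B where "B j = fst (s j)" for j
  define f where "f j = snd (s j)" for j
  have B: "piecewise_syndetic (B j)" "B j \<subseteq> T (f j)" and f: "f j \<in> {0..m}" for j
    using s(1)[of j] unfolding good_def B_def f_def by (auto split: prod.splits)
  have descend: "\<exists>n\<ge>1. \<forall>p x. (p, x) \<in> B (Suc (i + l)) \<longrightarrow>
      (\<forall>t\<in>{1..Suc k}. (p, x + int t * n) \<in> B i)" for i l
  proof (induction l)
    case 0
    then show ?case using s(2)[of i] unfolding step_def B_def by auto
  next
    case (Suc l)
    then obtain n where n: "n \<ge> 1" "\<And>p x t. (p, x) \<in> B (Suc (i + l)) \<Longrightarrow> t \<in> {1..Suc k} \<Longrightarrow>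
        (p, x + int t * n) \<in> B i"
      by blast
    obtain n' where n': "n' \<ge> 1" "\<And>p x t. (p, x) \<in> B (Suc (Suc (i + l))) \<Longrightarrow> t \<in> {1..Suc k} \<Longrightarrow>
        (p, x + int t * n') \<in> B (Suc (i + l))"
      using s(2)[of "Suc (i + l)"] unfolding step_def B_def by fast
    have "(p, x + int t * (n' + n)) \<in> B i"
      if "(p, x) \<in> B (Suc (Suc (i + l)))" "t \<in> {1..Suc k}" for p x t
      using n(2)[OF n'(2)[OF that] that(2)] by (simp add: algebra_simps)
    then show ?case using n(1) n'(1) by (intro exI[of _ "n' + n"]) auto
  qed
  have "\<not> inj f"
  proof
    assume "inj f"
    moreover have "finite (range f)" using f by (meson finite_atLeastAtMost_int finite_subset image_subsetI)
    ultimately show False using finite_imageD[of f UNIV] by simp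
  qed
  then obtain i j where ij: "i < j" "f i = f j"
    unfolding inj_on_def by (metis linorder_neqE_nat)
  obtain l where l: "j = Suc (i + l)" using ij(1) less_iff_Suc_add by auto
  obtain n where n: "n \<ge> 1" "\<And>p x t. (p, x) \<in> B j \<Longrightarrow> t \<in> {1..Suc k} \<Longrightarrow> (p, x + int t * n) \<in> B i"
    using descend[of i l] l by blast
  obtain p x where x: "(p, x) \<in> B j" using piecewise_syndetic_nonempty B(1) by blast
  have "(p, x + int t * n) \<in> T (f j)" if "t \<le> Suc k" for t
    using n(2)[OF x, of t] B(2)[of i] B(2)[of j] x ij(2) that by (cases "t = 0") auto
  then have "(q (int p), (a (int p) + x + f j) + int t * n) \<in> A" if "t \<le> Suc k" for t
    using that unfolding T_def by (simp add: algebra_simps)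
  then show ?thesis using n(1)
    by (intro exI[of _ "q (int p)"] exI[of _ "a (int p) + x + f j"] exI[of _ n]) simp
qed

theorem piecewise_syndetic_progression:
  assumes "piecewise_syndetic A"
  shows "\<exists>p x n. n \<ge> 1 \<and> (\<forall>i\<le>k. (p, x + int i * n) \<in> A)"
  using assms
proof (induction k arbitrary: A)
  case 0
  then obtain p x where "(p, x) \<in> A" using piecewise_syndetic_nonempty by blast
  then show ?case by (intro exI[of _ p] exI[of _ x] exI[of _ 1]) auto
next
  case (Suc k)
  show ?case
    using longer_progression[OF common_difference_piecewise_syndetic[OF Suc.IH] Suc.prems] .
qed

corollary piecewise_syndetic_symmetric_progressions:
  assumes "piecewise_syndetic A"
  shows "\<exists>n\<ge>1. piecewise_syndetic {(p, x). \<forall>e. \<bar>e\<bar> \<le> M \<longrightarrow> (p, x + e * n) \<in> A}"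
proof -
  define k where "k = nat (2 * M)"
  obtain n where n: "n \<ge> 1" "piecewise_syndetic {(p, x). \<forall>i\<le>k. (p, x + int i * n) \<in> A}"
    using common_difference_piecewise_syndetic[OF piecewise_syndetic_progression assms] by blast
  have "{(p, x). (p, x + - M * n) \<in> {(p, x). \<forall>i\<le>k. (p, x + int i * n) \<in> A}}
      \<subseteq> {(p, x). \<forall>e. \<bar>e\<bar> \<le> M \<longrightarrow> (p, x + e * n) \<in> A}"
  proof (rule subrelI)
    fix p x
    assume "(p, x) \<in> {(p, x). (p, x + - M * n) \<in> {(p, x). \<forall>i\<le>k. (p, x + int i * n) \<in> A}}"
    then have h: "(p, x + - M * n + int i * n) \<in> A" if "i \<le> k" for i using that by auto
    have "(p, x + e * n) \<in> A" if e: "\<bar>e\<bar> \<le> M" for e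
    proof -
      have "nat (e + M) \<le> k" "int (nat (e + M)) = e + M" using e by (auto simp: k_def)
      with h[of "nat (e + M)"] show ?thesis by (simp add: algebra_simps)
    qed
    then show "(p, x) \<in> {(p, x). \<forall>e. \<bar>e\<bar> \<le> M \<longrightarrow> (p, x + e * n) \<in> A}" by blast
  qed
  then show ?thesis
    using piecewise_syndetic_mono[OF piecewise_syndetic_translate[OF n(2)]] n(1) by blast
qed

section \<open>A multiple and many translates in one colour\<close>

text \<open>
  The chain consists of triples: a set \<open>B\<close>, a colour \<open>C\<close> that contains it, and the product \<open>Y\<close> of
  the factors used so far.  If \<open>w\<close> is the product of the factors between \<open>B i\<close> and
  \<open>B (j - 1)\<close>, then \<open>u + (w\<^sup>2 * d) * n \<in> B (j - 1)\<close> with \<open>u = w * z\<close> becomes, after division by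
  \<open>w\<close>, \<open>z + d * (w * n) \<in> B i\<close>, whereas \<open>D * n * u = D * (w * n) * z\<close> lies in \<open>B j\<close>.  Hence
  \<open>h = w * n\<close>.  The factor \<open>w\<close> depends on \<open>i\<close>, which is not known when \<open>n\<close> is chosen; but \<open>w \<le> Y\<close>,
  so it suffices to allow all \<open>e\<close> up to \<open>M * Y\<^sup>2\<close>.
\<close>

theorem monochromatic_multiple_and_translates:
  fixes P :: "nat set set" and D M :: int
  assumes "finite P" "{1..} \<subseteq> \<Union>P" "D \<ge> 1" "M \<ge> 0"
  shows "\<exists>C\<in>P. \<exists>h z. h \<ge> 1 \<and> nat (D * h * z) \<in> C \<and>
           (\<forall>d. \<bar>d\<bar> \<le> M \<longrightarrow> z + d * h \<ge> 1 \<and> nat (z + d * h) \<in> C)"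
proof -
  define pos where "pos = {(p::nat, x::int). x \<ge> 1}"
  define class_of where "class_of C = {(p::nat, x::int). nat x \<in> C}" for C
  have cover: "pos \<subseteq> (\<Union>C\<in>P. class_of C)"
  proof (rule subrelI)
    fix p x assume "(p, x) \<in> pos"
    then have "nat x \<in> \<Union>P" using assms(2) unfolding pos_def by (intro subsetD[OF assms(2)]) auto
    then show "(p, x) \<in> (\<Union>C\<in>P. class_of C)" unfolding class_of_def by auto
  qed
  have "\<exists>x. b \<le> x \<and> x \<le> b + 0 \<and> (0, x) \<in> pos" if "1 \<le> b" "b \<le> 1 + N" for N b
    using that unfolding pos_def by auto
  then have pos: "piecewise_syndetic pos"
    by (rule piecewise_syndeticI[where a = "\<lambda>_. 1" and m = 0 and p = "\<lambda>_. 0"])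
  define good where
    "good s \<longleftrightarrow> (case s of (B, C, Y) \<Rightarrow>
       piecewise_syndetic B \<and> B \<subseteq> pos \<inter> class_of C \<and> C \<in> P \<and> Y \<ge> 1)"
    for s :: "(nat \<times> int) set \<times> nat set \<times> int"
  define step where
    "step s s' \<longleftrightarrow> (case s of (B, C, Y) \<Rightarrow> case s' of (B', C', Y') \<Rightarrow>
       \<exists>n\<ge>1. Y' = D * n * Y \<and>
         (\<forall>p x. (p, x) \<in> B' \<longrightarrow>
           (\<exists>u. x = D * n * u \<and> (\<forall>e. \<bar>e\<bar> \<le> M * Y\<^sup>2 \<longrightarrow> (p, u + e * n) \<in> B))))"
    for s s' :: "(nat \<times> int) set \<times> nat set \<times> int"
  have "\<exists>s. \<forall>j. good (s j) \<and> step (s j) (s (Suc j))"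
  proof (rule dependent_nat_choice)
    obtain C where "C \<in> P" "piecewise_syndetic (pos \<inter> class_of C)"
      using piecewise_syndetic_cover[OF pos assms(1) cover] by auto
    then show "\<exists>s. good s" by (intro exI[of _ "(pos \<inter> class_of C, C, 1)"]) (simp add: good_def)
  next
    fix s assume "good s"
    then obtain B C Y where s: "s = (B, C, Y)" "piecewise_syndetic B" "B \<subseteq> pos" "Y \<ge> 1"
      by (auto simp: good_def)
    obtain n where n: "n \<ge> 1"
      "piecewise_syndetic {(p, u). \<forall>e. \<bar>e\<bar> \<le> M * Y\<^sup>2 \<longrightarrow> (p, u + e * n) \<in> B}"
      using piecewise_syndetic_symmetric_progressions[OF s(2)] by blast
    define E where "E = {(p, x). \<exists>u. x = D * n * u \<and>
        (p, u) \<in> {(p, u). \<forall>e. \<bar>e\<bar> \<le> M * Y\<^sup>2 \<longrightarrow> (p, u + e * n) \<in> B}}"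
    have Dn: "D * n \<ge> 1" using mult_mono[of 1 D 1 n] assms(3) n(1) by auto
    have E: "piecewise_syndetic E"
      unfolding E_def by (rule piecewise_syndetic_dilate[OF n(2) Dn])
    have EB: "\<exists>u. x = D * n * u \<and> (\<forall>e. \<bar>e\<bar> \<le> M * Y\<^sup>2 \<longrightarrow> (p, u + e * n) \<in> B)"
      if "(p, x) \<in> E" for p x
      using that unfolding E_def by auto
    have "E \<subseteq> pos"
    proof clarify
      fix p x assume "(p, x) \<in> E"
      then obtain u where u: "x = D * n * u" "\<And>e. \<bar>e\<bar> \<le> M * Y\<^sup>2 \<Longrightarrow> (p, u + e * n) \<in> B"
        using EB by blast
      have "(p, u) \<in> B" using u(2)[of 0] assms(4) by simp
      then have "u \<ge> 1" using s(3) unfolding pos_def by auto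
      then have "x \<ge> 1" unfolding u(1) using mult_mono[of 1 "D * n" 1 u] Dn by auto
      then show "(p, x) \<in> pos" by (simp add: pos_def)
    qed
    then obtain C' where "C' \<in> P" "piecewise_syndetic (E \<inter> class_of C')"
      using piecewise_syndetic_cover[OF E assms(1), of class_of] cover by blast
    moreover have "D * n * Y \<ge> 1" using mult_mono[of 1 "D * n" 1 Y] Dn s(4) by auto
    moreover have "step s (E \<inter> class_of C', C', D * n * Y)"
      unfolding step_def s(1) using EB n(1) by auto
    ultimately show "\<exists>s'. good s' \<and> step s s'" using \<open>E \<subseteq> pos\<close>
      by (intro exI[of _ "(E \<inter> class_of C', C', D * n * Y)"]) (auto simp: good_def)
  qed
  then obtain s where s: "\<And>j. good (s j)" "\<And>j. step (s j) (s (Suc j))" by blast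
  define B where "B j = fst (s j)" for j
  define C where "C j = fst (snd (s j))" for j
  define Y where "Y j = snd (snd (s j))" for j
  have B: "piecewise_syndetic (B j)" "B j \<subseteq> pos" "B j \<subseteq> class_of (C j)"
    and C: "C j \<in> P" and Y: "Y j \<ge> 1" for j
    using s(1)[of j] unfolding good_def B_def C_def Y_def by (auto split: prod.splits)
  have "\<forall>j. \<exists>n\<ge>1. Y (Suc j) = D * n * Y j \<and> (\<forall>p x. (p, x) \<in> B (Suc j) \<longrightarrow>
      (\<exists>u. x = D * n * u \<and> (\<forall>e. \<bar>e\<bar> \<le> M * (Y j)\<^sup>2 \<longrightarrow> (p, u + e * n) \<in> B j)))"
    using s(2) unfolding step_def B_def Y_def by (simp add: case_prod_beta)
  from choice[OF this] obtain n where n: "\<And>j. n j \<ge> 1" "\<And>j. Y (Suc j) = D * n j * Y j"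
    "\<And>j p x. (p, x) \<in> B (Suc j) \<Longrightarrow>
       \<exists>u. x = D * n j * u \<and> (\<forall>e. \<bar>e\<bar> \<le> M * (Y j)\<^sup>2 \<longrightarrow> (p, u + e * n j) \<in> B j)"
    by blast
  have descend: "\<exists>w\<ge>1. Y (i + l) = w * Y i \<and>
      (\<forall>p x. (p, x) \<in> B (i + l) \<longrightarrow> (\<exists>z. x = w * z \<and> (p, z) \<in> B i))" for i l
  proof (induction l)
    case 0
    then show ?case by (intro exI[of _ 1]) auto
  next
    case (Suc l)
    then obtain w where w: "w \<ge> 1" "Y (i + l) = w * Y i"
      "\<And>p x. (p, x) \<in> B (i + l) \<Longrightarrow> \<exists>z. x = w * z \<and> (p, z) \<in> B i"
      by blast
    let ?w = "D * n (i + l) * w"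
    have "D * n (i + l) \<ge> 1" using mult_mono[of 1 D 1 "n (i + l)"] assms(3) n(1) by auto
    then have "?w \<ge> 1" using mult_mono[of 1 "D * n (i + l)" 1 w] w(1) by auto
    moreover have "Y (i + Suc l) = ?w * Y i" using n(2)[of "i + l"] w(2) by simp
    moreover have "\<exists>z. x = ?w * z \<and> (p, z) \<in> B i" if x: "(p, x) \<in> B (i + Suc l)" for p x
    proof -
      obtain u where u: "x = D * n (i + l) * u"
        "\<And>e. \<bar>e\<bar> \<le> M * (Y (i + l))\<^sup>2 \<Longrightarrow> (p, u + e * n (i + l)) \<in> B (i + l)"
        using n(3)[of p x "i + l"] x by auto
      have "(p, u) \<in> B (i + l)" using u(2)[of 0] assms(4) by simp
      then show ?thesis using w(3) u(1) by fastforce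
    qed
    ultimately show ?case by blast
  qed
  have "\<not> inj C"
  proof
    assume "inj C"
    moreover have "finite (range C)" using C assms(1) by (meson finite_subset image_subsetI)
    ultimately show False using finite_imageD[of C UNIV] by simp
  qed
  then obtain i j where ij: "i < j" "C i = C j"
    unfolding inj_on_def by (metis linorder_neqE_nat)
  obtain l where l: "j = Suc (i + l)" using ij(1) less_iff_Suc_add by auto
  obtain w where w: "w \<ge> 1" "Y (i + l) = w * Y i"
    "\<And>p x. (p, x) \<in> B (i + l) \<Longrightarrow> \<exists>z. x = w * z \<and> (p, z) \<in> B i"
    using descend[of i l] by blast
  obtain p x where x: "(p, x) \<in> B j" using piecewise_syndetic_nonempty B(1) by blast
  obtain u where u: "x = D * n (i + l) * u"
    "\<And>e. \<bar>e\<bar> \<le> M * (Y (i + l))\<^sup>2 \<Longrightarrow> (p, u + e * n (i + l)) \<in> B (i + l)"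
    using n(3)[of p x "i + l"] x l by auto
  have "(p, u) \<in> B (i + l)" using u(2)[of 0] assms(4) by simp
  then obtain z where z: "u = w * z" using w(3) by blast
  define h where "h = w * n (i + l)"
  have h: "h \<ge> 1" using mult_mono[of 1 w 1 "n (i + l)"] w(1) n(1) unfolding h_def by auto
  have xz: "x = D * h * z" using u(1) z by (simp add: h_def)
  have inB: "(p, z + d * h) \<in> B i" if d: "\<bar>d\<bar> \<le> M" for d
  proof -
    have "w \<le> Y (i + l)" using w(2) mult_left_mono[of 1 "Y i" w] Y w(1) by auto
    then have "w\<^sup>2 \<le> (Y (i + l))\<^sup>2" using w(1) by (intro power_mono) auto
    then have "\<bar>d\<bar> * w\<^sup>2 \<le> M * (Y (i + l))\<^sup>2" using d by (intro mult_mono) auto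
    then have "\<bar>d * w\<^sup>2\<bar> \<le> M * (Y (i + l))\<^sup>2" by (simp add: abs_mult)
    then have "(p, u + d * w\<^sup>2 * n (i + l)) \<in> B (i + l)" by (rule u(2))
    then obtain z' where z': "u + d * w\<^sup>2 * n (i + l) = w * z'" "(p, z') \<in> B i"
      using w(3) by blast
    have "w * z' = w * (z + d * h)"
      using z'(1) z by (simp add: h_def algebra_simps power2_eq_square)
    then have "z' = z + d * h" using w(1) by simp
    then show ?thesis using z'(2) by simp
  qed
  have "nat (D * h * z) \<in> C i" using x xz B(3)[of j] ij(2) unfolding class_of_def by auto
  moreover have "z + d * h \<ge> 1 \<and> nat (z + d * h) \<in> C i" if "\<bar>d\<bar> \<le> M" for d
    using inB[OF that] B(2)[of i] B(3)[of i] unfolding pos_def class_of_def by auto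
  ultimately show ?thesis using C[of i] h by blast
qed

section \<open>The quadratic equation\<close>

text \<open>
  Write \<open>Q\<close> for the quadratic form with coefficients \<open>c\<close>, and let \<open>S = \<Sum> c i * v i\<close> for distinct
  \<open>v i\<close>.  Since \<open>\<Sum> c i = 0\<close>, \<open>Q (2 * S * v - t)\<close> equals \<open>4 * S\<^sup>2 * (Q v - t)\<close> for a constant shift
  \<open>t\<close>, so \<open>t = Q v\<close> makes the vector isotropic.  Its linear form is \<open>2 * S\<^sup>2\<close>, positive
  as soon as \<open>S \<noteq> 0\<close>.  If \<open>v i = i\<close> gives \<open>S = 0\<close>, raising the last entry by one repairs this.
\<close>

lemma isotropic_vector_exists:
  fixes c :: "nat \<Rightarrow> int"
  assumes "k \<ge> 1" "c k \<noteq> 0" "(\<Sum>i=1..k. c i) = 0"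
  shows "\<exists>d. inj_on d {1..k} \<and> (\<Sum>i=1..k. c i * (d i)\<^sup>2) = 0 \<and> (\<Sum>i=1..k. c i * d i) > 0"
proof -
  obtain v :: "nat \<Rightarrow> int" where v: "inj_on v {1..k}" "(\<Sum>i=1..k. c i * v i) \<noteq> 0"
  proof (cases "(\<Sum>i=1..k. c i * int i) = 0")
    case False
    moreover have "inj_on int {1..k}" by simp
    ultimately show ?thesis using that by blast
  next
    case True
    define v where "v i = int i + (if i = k then 1 else 0)" for i
    have "(\<Sum>i=1..k. c i * v i) = (\<Sum>i=1..k. c i * int i) + (\<Sum>i=1..k. if i = k then c i else 0)"
      unfolding sum.distrib[symmetric] v_def by (rule sum.cong) (auto simp: algebra_simps)
    also have "\<dots> = c k" using True assms(1) by simp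
    finally have "(\<Sum>i=1..k. c i * v i) \<noteq> 0" using assms(2) by simp
    moreover have "inj_on v {1..k}" by (rule inj_onI) (simp add: v_def split: if_splits)
    ultimately show ?thesis using that by blast
  qed
  define S where "S = (\<Sum>i=1..k. c i * v i)"
  define q where "q = (\<Sum>i=1..k. c i * (v i)\<^sup>2)"
  define d where "d i = 2 * S * v i - q" for i
  have "S \<noteq> 0" using v(2) by (simp add: S_def)
  have "inj_on d {1..k}"
  proof (rule inj_onI)
    fix i j assume ij: "i \<in> {1..k}" "j \<in> {1..k}" "d i = d j"
    then have "v i = v j" using \<open>S \<noteq> 0\<close> by (simp add: d_def)
    then show "i = j" using inj_onD[OF v(1)] ij by blast
  qed
  moreover have "(\<Sum>i=1..k. c i * (d i)\<^sup>2) =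
      (\<Sum>i=1..k. 4 * S\<^sup>2 * (c i * (v i)\<^sup>2) - 4 * S * q * (c i * v i) + q\<^sup>2 * c i)"
    by (rule sum.cong) (auto simp: d_def power2_eq_square algebra_simps)
  then have "(\<Sum>i=1..k. c i * (d i)\<^sup>2) = 4 * S\<^sup>2 * q - 4 * S * q * S + q\<^sup>2 * 0"
    by (simp only: sum.distrib sum_subtractf sum_distrib_left[symmetric] S_def q_def assms(3))
  then have "(\<Sum>i=1..k. c i * (d i)\<^sup>2) = 0" by (simp add: power2_eq_square)
  moreover have "(\<Sum>i=1..k. c i * d i) = (\<Sum>i=1..k. 2 * S * (c i * v i) - q * c i)"
    by (rule sum.cong) (auto simp: d_def algebra_simps)
  then have "(\<Sum>i=1..k. c i * d i) = 2 * S * S - q * 0"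
    by (simp only: sum_subtractf sum_distrib_left[symmetric] S_def assms(3))
  then have "(\<Sum>i=1..k. c i * d i) > 0"
    using \<open>S \<noteq> 0\<close> by (auto simp: zero_less_mult_iff linorder_neq_iff)
  ultimately show ?thesis by blast
qed

theorem corollary1p7:
  fixes k :: nat and c :: "nat \<Rightarrow> int" and P :: "nat set set"
  assumes "k \<ge> 1"
    and "\<And>i. i \<in> {1..k} \<Longrightarrow> c i \<noteq> 0"
    and "(\<Sum>i=1..k. c i) = 0"
    and "partition_on {1..} P" and "finite P"
  shows "\<exists>C\<in>P. \<exists>a :: nat \<Rightarrow> nat.
           inj_on a {0..k} \<and> (\<forall>i\<in>{0..k}. a i \<in> C) \<and>
           (\<Sum>i=1..k. c i * (int (a i))\<^sup>2) = int (a 0)"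
proof -
  obtain d where d: "inj_on d {1..k}" "(\<Sum>i=1..k. c i * (d i)\<^sup>2) = 0" "(\<Sum>i=1..k. c i * d i) > 0"
    using isotropic_vector_exists[of k c] assms(1-3) by auto
  define D where "D = 2 * (\<Sum>i=1..k. c i * d i)"
  define M where "M = (\<Sum>i=1..k. \<bar>d i\<bar>)"
  have D: "D \<ge> 2" using d(3) by (simp add: D_def)
  have M: "M \<ge> 0" unfolding M_def by (simp add: sum_nonneg)
  have dM: "\<bar>d i\<bar> \<le> M" if "i \<in> {1..k}" for i
    unfolding M_def using member_le_sum[OF that, of "\<lambda>i. \<bar>d i\<bar>"] by simp
  have "{1..} \<subseteq> \<Union>P" using assms(4) by (simp add: partition_on_def)
  then obtain C h z where C: "C \<in> P" "h \<ge> 1" "nat (D * h * z) \<in> C"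
    and tr: "\<And>e. \<bar>e\<bar> \<le> M \<Longrightarrow> z + e * h \<ge> 1 \<and> nat (z + e * h) \<in> C"
    using monochromatic_multiple_and_translates[of P D M] assms(5) D M by auto
  define a where "a i = nat (if i = 0 then D * h * z else z + d i * h)" for i
  \<comment> \<open>The translate by \<open>- M * h\<close> is still positive; hence \<open>z\<close> exceeds every \<open>d i * h\<close>, and
    \<open>D * h * z \<ge> 2 * z\<close> exceeds every \<open>z + d i * h\<close>.\<close>
  have z: "z \<ge> 1 + M * h" using tr[of "- M"] M by simp
  have "M * h \<ge> 0" using M C(2) by simp
  have "2 * 1 \<le> D * h" using mult_mono[of 2 D 1 h] D C(2) by auto
  then have "2 * z \<le> D * h * z" using z \<open>M * h \<ge> 0\<close> by (intro mult_right_mono) auto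
  have a0: "int (a 0) = D * h * z"
    using \<open>2 * z \<le> D * h * z\<close> z \<open>M * h \<ge> 0\<close> by (simp add: a_def)
  have ai: "int (a i) = z + d i * h" "a i \<in> C" if "i \<in> {1..k}" for i
    using tr[OF dM[OF that]] that by (auto simp: a_def)
  have less: "a i < a 0" if "i \<in> {1..k}" for i
  proof -
    have "d i * h \<le> M * h" using dM[OF that] C(2) by (intro mult_right_mono) auto
    then have "int (a i) < int (a 0)"
      unfolding a0 ai(1)[OF that] using z \<open>2 * z \<le> D * h * z\<close> by linarith
    then show ?thesis by simp
  qed
  have split: "{0..k} = insert 0 {1..k}" by auto
  have "inj_on a {1..k}"
  proof (rule inj_onI)
    fix i j assume ij: "i \<in> {1..k}" "j \<in> {1..k}" "a i = a j"
    then have "d i * h = d j * h" using ai(1)[OF ij(1)] ai(1)[OF ij(2)] by linarith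
    then have "d i = d j" using C(2) by simp
    then show "i = j" using inj_onD[OF d(1)] ij by blast
  qed
  then have "inj_on a {0..k}" unfolding split using less by fastforce
  moreover have "\<forall>i\<in>{0..k}. a i \<in> C" unfolding split using C(3) ai(2) by (simp add: a_def)
  moreover have "(\<Sum>i=1..k. c i * (int (a i))\<^sup>2) =
      (\<Sum>i=1..k. z\<^sup>2 * c i + 2 * h * z * (c i * d i) + h\<^sup>2 * (c i * (d i)\<^sup>2))"
    by (rule sum.cong) (auto simp: ai(1) power2_eq_square algebra_simps)
  then have "(\<Sum>i=1..k. c i * (int (a i))\<^sup>2) = int (a 0)"
    unfolding a0 by (simp del: One_nat_def add: sum.distrib sum_distrib_left[symmetric] assms(3) d(2) D_def)
  ultimately show ?thesis using C(1) by blast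
qed

end
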